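(* Let $d\ge 1$. Let $\mathcal{P}_N$ (resp. $\mathcal{P}_S$) be the problem of deciding whether two given stochastic cellular automata of dimension $d$ have the same non-deterministic (resp. stochastic) global function, i.e. whether $\mathcal{N}_F=\mathcal{N}_G$ (resp. $\mathcal{S}_F=\mathcal{S}_G$), where $F$ and $G$ are their explicit global functions. Then the surjectivity problem of classical deterministic cellular automata of dimension $d$ (given a classical cellular automaton, is its global map $Q^{\mathbb{Z}^d}\to Q^{\mathbb{Z}^d}$ surjective?) is (computably) reducible to both $\mathcal{P}_N$ and $\mathcal{P}_S$.
   Context: A stochastic cellular automaton (stochastic CA) of dimension $d$ is a tuple $\mathcal{A}=(Q,R,V,V',f)$ where $Q$ (states) and $R$ (random symbols) are finite sets, $V=\{v_1,\dots,v_\rho\}$ and $V'=\{v'_1,\dots,v'_{\rho'}\}$ are finite subsets of $\mathbb{Z}^d$, and $f:Q^\rho\times R^{\rho'}\to Q$ is the local function. Its explicit global function $F:Q^{\mathbb{Z}^d}\times R^{\mathbb{Z}^d}\to Q^{\mathbb{Z}^d}$ is $F(c,s)_z=f\big((c_{z+v_1},\dots,c_{z+v_\rho}),(s_{z+v'_1},\dots,s_{z+v'_{\rho'}})\big)$. Its non-deterministic global function maps a configuration $c\in Q^{\mathbb{Z}^d}$ to the set $\mathcal{N}_F(c)=\{F(c,s):s\in R^{\mathbb{Z}^d}\}$. Its stochastic global function maps $c$ to the Borel probability measure $\mathcal{S}_F(c)$ on $Q^{\mathbb{Z}^d}$ that is the law of $F(c,s)$ when $s$ is drawn from the uniform (i.i.d.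 uniform product) measure $\nu_R$ on $R^{\mathbb{Z}^d}$, i.e. $\mathcal{S}_F(c)(E)=\nu_R(\{s:F(c,s)\in E\})$. Two stochastic CA may have different sets of random symbols and neighborhoods. CA are given as inputs by their finite description $(Q,R,V,V',f)$. *)

theory Defs
  imports "HOL-Probability.Probability" "HOL-Library.Nat_Bijection"
begin

section \<open>Configurations over the lattice\<close>

definition cells :: "nat \<Rightarrow> int list set" where
  "cells d = {z. length z = d}"

definition shift :: "int list \<Rightarrow> int list \<Rightarrow> int list" where
  "shift z v = map2 (+) z v"

text \<open>Configurations are extensional functions: they take the value \<^term>\<open>undefined\<close>
  outside \<^term>\<open>cells d\<close>, so equality of configurations is equality on the lattice.\<close>

definition configs :: "nat \<Rightarrow> 'q set \<Rightarrow> (int list \<Rightarrow> 'q) set" where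
  "configs d Q = (\<Pi>\<^sub>E z\<in>cells d. Q)"

definition tuples :: "'q set \<Rightarrow> nat \<Rightarrow> 'q list set" where
  "tuples Q n = {us. length us = n \<and> set us \<subseteq> Q}"

definition is_nbhd :: "nat \<Rightarrow> int list list \<Rightarrow> bool" where
  "is_nbhd d V \<longleftrightarrow> distinct V \<and> set V \<subseteq> cells d"


section \<open>Stochastic cellular automata\<close>

text \<open>The neighbourhoods are given with the enumeration of their elements that the local
  function refers to.\<close>

record ('q, 'r) stochastic_ca =
  states :: "'q set"
  rsyms :: "'r set"
  nbhd :: "int list list"
  rnbhd :: "int list list"
  local_fun :: "'q list \<times> 'r list \<Rightarrow> 'q"

definition is_sca :: "nat \<Rightarrow> ('q, 'r) stochastic_ca \<Rightarrow> bool" where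
  "is_sca d A \<longleftrightarrow>
     finite (states A) \<and> states A \<noteq> {} \<and> finite (rsyms A) \<and> rsyms A \<noteq> {} \<and>
     is_nbhd d (nbhd A) \<and> is_nbhd d (rnbhd A) \<and>
     local_fun A \<in> tuples (states A) (length (nbhd A)) \<times> tuples (rsyms A) (length (rnbhd A))
       \<rightarrow> states A"

definition explicit_global ::
  "nat \<Rightarrow> ('q, 'r) stochastic_ca \<Rightarrow> (int list \<Rightarrow> 'q) \<Rightarrow> (int list \<Rightarrow> 'r) \<Rightarrow> (int list \<Rightarrow> 'q)" where
  "explicit_global d A c s =
     (\<lambda>z\<in>cells d. local_fun A (map (\<lambda>v. c (shift z v)) (nbhd A),
                              map (\<lambda>v. s (shift z v)) (rnbhd A)))"

definition nondet_global ::
  "nat \<Rightarrow> ('q, 'r) stochastic_ca \<Rightarrow> (int list \<Rightarrow> 'q) \<Rightarrow> (int list \<Rightarrow> 'q) set" where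
  "nondet_global d A c = {explicit_global d A c s | s. s \<in> configs d (rsyms A)}"

definition config_algebra :: "nat \<Rightarrow> 'q set \<Rightarrow> (int list \<Rightarrow> 'q) measure" where
  "config_algebra d Q = (\<Pi>\<^sub>M z\<in>cells d. count_space Q)"

definition uniform_config_measure :: "nat \<Rightarrow> 'r set \<Rightarrow> (int list \<Rightarrow> 'r) measure" where
  "uniform_config_measure d R = (\<Pi>\<^sub>M z\<in>cells d. uniform_count_measure R)"

text \<open>The product \<open>\<sigma>\<close>-algebra of countably many finite discrete spaces is the Borel
  \<open>\<sigma>\<close>-algebra of their product topology.  The pushforward is the law of
  \<^term>\<open>explicit_global d A c s\<close>, because this is a measurable function of \<open>s\<close>
  (lemma \<open>measurable_explicit_global\<close> below).\<close>

definition stochastic_global ::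
  "nat \<Rightarrow> ('q, 'r) stochastic_ca \<Rightarrow> (int list \<Rightarrow> 'q) \<Rightarrow> (int list \<Rightarrow> 'q) measure" where
  "stochastic_global d A c =
     distr (uniform_config_measure d (rsyms A)) (config_algebra d (states A))
       (explicit_global d A c)"

lemma shift_in_cells: "z \<in> cells d \<Longrightarrow> v \<in> cells d \<Longrightarrow> shift z v \<in> cells d"
  by (simp add: cells_def shift_def)

lemma finite_tuples: "finite Q \<Longrightarrow> finite (tuples Q n)"
  using finite_lists_length_eq[of Q n] by (simp add: tuples_def conj_commute)

lemma measurable_explicit_global:
  assumes A: "is_sca d A" and c: "c \<in> configs d (states A)"
  shows "explicit_global d A c
           \<in> uniform_config_measure d (rsyms A) \<rightarrow>\<^sub>M config_algebra d (states A)"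
  unfolding config_algebra_def explicit_global_def
proof (rule measurable_restrict)
  fix z assume z: "z \<in> cells d"
  let ?M = "uniform_config_measure d (rsyms A)"
  let ?us = "map (\<lambda>v. c (shift z v)) (nbhd A)"
  let ?w = "\<lambda>s. map (\<lambda>v. s (shift z v)) (rnbhd A)"
  let ?T = "tuples (rsyms A) (length (rnbhd A))"
  have in_cells: "shift z v \<in> cells d" if "v \<in> set (nbhd A) \<union> set (rnbhd A)" for v
    using A z that by (auto simp: is_sca_def is_nbhd_def intro!: shift_in_cells)
  have us: "?us \<in> tuples (states A) (length (nbhd A))"
    using c in_cells by (auto simp: tuples_def configs_def)
  have space: "space ?M = configs d (rsyms A)"
    by (simp add: uniform_config_measure_def configs_def space_PiM space_uniform_count_measure)
  have w: "?w s \<in> ?T" if "s \<in> space ?M" for s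
    using that in_cells by (auto simp: tuples_def space configs_def)
  have "?w \<in> ?M \<rightarrow>\<^sub>M count_space ?T"
  proof (subst measurable_count_space_eq2, goal_cases)
    case 1
    show ?case using A by (auto simp: is_sca_def intro: finite_tuples)
  next
    case 2
    have "?w -` {ws} \<inter> space ?M \<in> sets ?M" if ws: "ws \<in> ?T" for ws
    proof -
      have "?w -` {ws} \<inter> space ?M =
          {s \<in> space ?M. \<forall>i\<in>{..<length (rnbhd A)}. s (shift z (rnbhd A ! i)) = ws ! i}"
        using ws by (auto simp: tuples_def list_eq_iff_nth_eq)
      also have "\<dots> \<in> sets ?M"
      proof (rule sets.sets_Collect_finite_All, goal_cases)
        case (1 i)
        then have "shift z (rnbhd A ! i) \<in> cells d"
          by (intro in_cells) auto
        then have "(\<lambda>s. s (shift z (rnbhd A ! i))) \<in> ?M \<rightarrow>\<^sub>M uniform_count_measure (rsyms A)"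
          unfolding uniform_config_measure_def by (rule measurable_component_singleton)
        moreover have "{ws ! i} \<in> sets (uniform_count_measure (rsyms A))"
          using 1 ws by (auto simp: sets_uniform_count_measure tuples_def)
        ultimately have "(\<lambda>s. s (shift z (rnbhd A ! i))) -` {ws ! i} \<inter> space ?M \<in> sets ?M"
          by (rule measurable_sets)
        then show ?case by (simp add: vimage_def Int_def conj_commute)
      qed simp
      finally show ?thesis .
    qed
    then show ?case using w by auto
  qed
  moreover have "(\<lambda>ws. local_fun A (?us, ws)) \<in> count_space ?T \<rightarrow>\<^sub>M count_space (states A)"
    using A us by (auto simp: is_sca_def)
  ultimately show "(\<lambda>s. local_fun A (?us, ?w s)) \<in> ?M \<rightarrow>\<^sub>M count_space (states A)"
    by (rule measurable_compose)
qed

text \<open>The global functions of an automaton are functions on \<^term>\<open>configs d (states A)\<close>, so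
  being equal includes having the same domain.  The sets of random symbols are unrelated.\<close>

definition same_nondet ::
  "nat \<Rightarrow> ('q, 'r) stochastic_ca \<Rightarrow> ('q, 's) stochastic_ca \<Rightarrow> bool" where
  "same_nondet d A B \<longleftrightarrow>
     states A = states B \<and>
     (\<forall>c\<in>configs d (states A). nondet_global d A c = nondet_global d B c)"

definition same_stochastic ::
  "nat \<Rightarrow> ('q, 'r) stochastic_ca \<Rightarrow> ('q, 's) stochastic_ca \<Rightarrow> bool" where
  "same_stochastic d A B \<longleftrightarrow>
     states A = states B \<and>
     (\<forall>c\<in>configs d (states A). stochastic_global d A c = stochastic_global d B c)"


section \<open>Classical deterministic cellular automata\<close>

record 'q classical_ca =
  ca_states :: "'q set"
  ca_nbhd :: "int list list"
  ca_local_fun :: "'q list \<Rightarrow> 'q"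

definition is_ca :: "nat \<Rightarrow> 'q classical_ca \<Rightarrow> bool" where
  "is_ca d A \<longleftrightarrow>
     finite (ca_states A) \<and> ca_states A \<noteq> {} \<and> is_nbhd d (ca_nbhd A) \<and>
     ca_local_fun A \<in> tuples (ca_states A) (length (ca_nbhd A)) \<rightarrow> ca_states A"

definition ca_global ::
  "nat \<Rightarrow> 'q classical_ca \<Rightarrow> (int list \<Rightarrow> 'q) \<Rightarrow> (int list \<Rightarrow> 'q)" where
  "ca_global d A c = (\<lambda>z\<in>cells d. ca_local_fun A (map (\<lambda>v. c (shift z v)) (ca_nbhd A)))"

definition ca_surjective :: "nat \<Rightarrow> 'q classical_ca \<Rightarrow> bool" where
  "ca_surjective d A \<longleftrightarrow>
     ca_global d A ` configs d (ca_states A) = configs d (ca_states A)"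


section \<open>Finite descriptions and their codes\<close>

text \<open>Symbols are named by natural numbers, finite sets are listed without repetition, and the
  local function is given by its graph, listed in any order.\<close>

type_synonym sca_desc =
  "nat list \<times> nat list \<times> int list list \<times> int list list \<times> ((nat list \<times> nat list) \<times> nat) list"

type_synonym ca_desc = "nat list \<times> int list list \<times> (nat list \<times> nat) list"

fun sca_of :: "sca_desc \<Rightarrow> (nat, nat) stochastic_ca" where
  "sca_of (Q, R, V, V', T) =
     \<lparr>states = set Q, rsyms = set R, nbhd = V, rnbhd = V', local_fun = (\<lambda>x. the (map_of T x))\<rparr>"

fun is_sca_desc :: "nat \<Rightarrow> sca_desc \<Rightarrow> bool" where
  "is_sca_desc d (Q, R, V, V', T) \<longleftrightarrow>
     distinct Q \<and> distinct R \<and> distinct (map fst T) \<and>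
     set (map fst T) = tuples (set Q) (length V) \<times> tuples (set R) (length V') \<and>
     is_sca d (sca_of (Q, R, V, V', T))"

fun ca_of :: "ca_desc \<Rightarrow> nat classical_ca" where
  "ca_of (Q, V, T) =
     \<lparr>ca_states = set Q, ca_nbhd = V, ca_local_fun = (\<lambda>x. the (map_of T x))\<rparr>"

fun is_ca_desc :: "nat \<Rightarrow> ca_desc \<Rightarrow> bool" where
  "is_ca_desc d (Q, V, T) \<longleftrightarrow>
     distinct Q \<and> distinct (map fst T) \<and>
     set (map fst T) = tuples (set Q) (length V) \<and>
     is_ca d (ca_of (Q, V, T))"

definition code_pair :: "('a \<Rightarrow> nat) \<Rightarrow> ('b \<Rightarrow> nat) \<Rightarrow> 'a \<times> 'b \<Rightarrow> nat" where
  "code_pair e e' p = prod_encode (e (fst p), e' (snd p))"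

definition code_list :: "('a \<Rightarrow> nat) \<Rightarrow> 'a list \<Rightarrow> nat" where
  "code_list e xs = list_encode (map e xs)"

definition code_syms :: "nat list \<Rightarrow> nat" where
  "code_syms = code_list (\<lambda>n. n)"

definition code_nbhd :: "int list list \<Rightarrow> nat" where
  "code_nbhd = code_list (code_list int_encode)"

definition code_sca :: "sca_desc \<Rightarrow> nat" where
  "code_sca =
     code_pair code_syms (code_pair code_syms (code_pair code_nbhd (code_pair code_nbhd
       (code_list (code_pair (code_pair code_syms code_syms) (\<lambda>n. n))))))"

definition code_ca :: "ca_desc \<Rightarrow> nat" where
  "code_ca =
     code_pair code_syms (code_pair code_nbhd (code_list (code_pair code_syms (\<lambda>n. n))))"

lemma inj_code_pair: "inj e \<Longrightarrow> inj e' \<Longrightarrow> inj (code_pair e e')"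
  by (auto simp: inj_def code_pair_def)

lemma inj_code_list: "inj e \<Longrightarrow> inj (code_list e)"
  by (rule injI) (simp add: code_list_def list_encode_eq inj_map_eq_map)

lemma inj_code_syms: "inj code_syms"
  and inj_code_nbhd: "inj code_nbhd"
  unfolding code_syms_def code_nbhd_def
  by (intro inj_code_list inj_int_encode; simp add: inj_def)+

lemma inj_code_sca: "inj code_sca"
  and inj_code_ca: "inj code_ca"
  unfolding code_sca_def code_ca_def
  by (intro inj_code_pair inj_code_list inj_code_syms inj_code_nbhd; simp add: inj_def)+


section \<open>Computable functions and reducibility\<close>

text \<open>\<open>total_recursive k f\<close>: the total function that \<open>f\<close> computes on argument lists of length
  \<open>k\<close> is recursive.  Minimisation is only applied to functions that have a zero for all values
  of the parameters; by Kleene's normal form theorem this class consists of all total functions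
  among the partial recursive ones.\<close>

inductive total_recursive :: "nat \<Rightarrow> (nat list \<Rightarrow> nat) \<Rightarrow> bool" where
  zero: "total_recursive k (\<lambda>xs. 0)"
| succ: "total_recursive 1 (\<lambda>xs. Suc (xs ! 0))"
| proj: "i < k \<Longrightarrow> total_recursive k (\<lambda>xs. xs ! i)"
| comp: "total_recursive (length gs) f \<Longrightarrow> (\<forall>g\<in>set gs. total_recursive k g) \<Longrightarrow>
    total_recursive k (\<lambda>xs. f (map (\<lambda>g. g xs) gs))"
| prim_rec: "total_recursive k f \<Longrightarrow> total_recursive (Suc (Suc k)) g \<Longrightarrow>
    total_recursive (Suc k)
      (\<lambda>xs. rec_nat (f (tl xs)) (\<lambda>n r. g (n # r # tl xs)) (hd xs))"
| minim: "total_recursive (Suc k) f \<Longrightarrow> (\<forall>xs. length xs = k \<longrightarrow> (\<exists>n. f (n # xs) = 0)) \<Longrightarrow>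
    total_recursive k (\<lambda>xs. LEAST n. f (n # xs) = 0)"

definition computable :: "(nat \<Rightarrow> nat) \<Rightarrow> bool" where
  "computable h \<longleftrightarrow> (\<exists>f. total_recursive 1 f \<and> (\<forall>n. h n = f [n]))"

text \<open>A decision problem is a set of instances together with those whose answer is yes, both
  given by their codes.  A (many-one) reduction maps instances to instances with the same
  answer.\<close>

record decision_problem =
  instances :: "nat set"
  yes_instances :: "nat set"

definition reducible :: "decision_problem \<Rightarrow> decision_problem \<Rightarrow> bool" where
  "reducible P P' \<longleftrightarrow>
     (\<exists>h. computable h \<and>
        (\<forall>n\<in>instances P. h n \<in> instances P' \<and>
           (n \<in> yes_instances P \<longleftrightarrow> h n \<in> yes_instances P')))"

definition surjectivity_problem :: "nat \<Rightarrow> decision_problem" where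
  "surjectivity_problem d =
     \<lparr>instances = {code_ca D | D. is_ca_desc d D},
      yes_instances = {code_ca D | D. is_ca_desc d D \<and> ca_surjective d (ca_of D)}\<rparr>"

definition nondet_equality_problem :: "nat \<Rightarrow> decision_problem" where
  "nondet_equality_problem d =
     \<lparr>instances = {code_pair code_sca code_sca (D, E) | D E. is_sca_desc d D \<and> is_sca_desc d E},
      yes_instances = {code_pair code_sca code_sca (D, E) | D E.
        is_sca_desc d D \<and> is_sca_desc d E \<and> same_nondet d (sca_of D) (sca_of E)}\<rparr>"

definition stochastic_equality_problem :: "nat \<Rightarrow> decision_problem" where
  "stochastic_equality_problem d =
     \<lparr>instances = {code_pair code_sca code_sca (D, E) | D E. is_sca_desc d D \<and> is_sca_desc d E},
      yes_instances = {code_pair code_sca code_sca (D, E) | D E.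
        is_sca_desc d D \<and> is_sca_desc d E \<and> same_stochastic d (sca_of D) (sca_of E)}\<rparr>"

end

theory Submission
  imports Defs
begin

text \<open>To a classical automaton with states \<open>Q\<close> and global map \<open>F\<close> associate two stochastic automata
  with states and random symbols \<open>Q\<close>, both ignoring the current configuration: the first one outputs
  \<open>F s\<close>, the second one outputs the random configuration \<open>s\<close> itself.  They have the same
  non-deterministic global function iff \<open>F\<close> is surjective, and the same stochastic global function
  iff \<open>F\<close> preserves the uniform measure \<open>\<mu>\<close>.  The latter is equivalent to surjectivity.  If
  \<open>F\<close> preserves \<open>\<mu>\<close>, every pattern has a preimage, and compactness yields preimages of
  configurations.  Conversely, if \<open>F\<close> is surjective, an event \<open>X\<close> depending on finitely many cells
  satisfies \<open>\<mu> (F -` X) \<ge> \<mu> X\<close>, by comparing the powers of both sides given by independent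
  translates; the same bound for the complement gives equality.\<close>

section \<open>Computable functions\<close>

text \<open>The class \<^const>\<open>total_recursive\<close> is not invariant under changing a function on lists of the
  wrong length; closure properties hold more smoothly for functions that are only compared on
  lists of length \<open>k\<close>.\<close>

definition recursive_fun :: "nat \<Rightarrow> (nat list \<Rightarrow> nat) \<Rightarrow> bool" where
  "recursive_fun k f \<longleftrightarrow> (\<exists>g. total_recursive k g \<and> (\<forall>xs. length xs = k \<longrightarrow> g xs = f xs))"

lemma recursive_fun_cong:
  assumes "recursive_fun k f" "\<And>xs. length xs = k \<Longrightarrow> f xs = g xs"
  shows "recursive_fun k g"
  using assms unfolding recursive_fun_def by (metis (no_types))

lemma recursive_proj: "i < k \<Longrightarrow> recursive_fun k (\<lambda>xs. xs ! i)"
  unfolding recursive_fun_def using total_recursive.proj by blast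

text \<open>The representatives of \<open>gs\<close> produce an argument list of length
  \<open>length gs\<close>, and there the representative of \<open>f\<close> agrees with
  \<open>f\<close>.\<close>

lemma recursive_comp:
  assumes f: "recursive_fun (length gs) f" and gs: "\<forall>g\<in>set gs. recursive_fun k g"
  shows "recursive_fun k (\<lambda>xs. f (map (\<lambda>g. g xs) gs))"
proof -
  obtain f' where f': "total_recursive (length gs) f'"
    "\<And>xs. length xs = length gs \<Longrightarrow> f' xs = f xs"
    using f unfolding recursive_fun_def by blast
  obtain T where T: "\<And>g. g \<in> set gs \<Longrightarrow> total_recursive k (T g)"
    "\<And>g xs. g \<in> set gs \<Longrightarrow> length xs = k \<Longrightarrow> T g xs = g xs"
    using gs unfolding recursive_fun_def by metis
  have "total_recursive k (\<lambda>xs. f' (map (\<lambda>g. g xs) (map T gs)))"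
    by (rule total_recursive.comp) (use f' T in auto)
  moreover have "f' (map (\<lambda>g. g xs) (map T gs)) = f (map (\<lambda>g. g xs) gs)" if "length xs = k" for xs
  proof -
    have "map (\<lambda>g. g xs) (map T gs) = map (\<lambda>g. g xs) gs"
      using T(2) that by simp
    then show ?thesis using f'(2)[of "map (\<lambda>g. g xs) (map T gs)"] by (metis length_map)
  qed
  ultimately show ?thesis unfolding recursive_fun_def by blast
qed

lemma recursive_comp1:
  assumes "recursive_fun 1 (\<lambda>xs. f (xs ! 0))" "recursive_fun k a"
  shows "recursive_fun k (\<lambda>xs. f (a xs))"
  using recursive_comp[of "[a]" "\<lambda>xs. f (xs ! 0)" k] assms by simp

lemma recursive_zero: "recursive_fun k (\<lambda>xs. 0)"
  unfolding recursive_fun_def using total_recursive.zero by blast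

lemma recursive_Suc: "recursive_fun k a \<Longrightarrow> recursive_fun k (\<lambda>xs. Suc (a xs))"
  by (rule recursive_comp1) (use total_recursive.succ in \<open>auto simp: recursive_fun_def\<close>)

lemma recursive_const: "recursive_fun k (\<lambda>xs. c)"
  by (induction c) (auto intro: recursive_zero recursive_Suc)

text \<open>In \<open>recursive_rec_nat\<close> the step function finds the counter and the
  accumulator in front of the parameters; dropping two entries recovers the parameters.\<close>

lemma recursive_drop2:
  assumes "recursive_fun k c"
  shows "recursive_fun (Suc (Suc k)) (\<lambda>ys. c (drop 2 ys))"
proof -
  let ?gs = "map (\<lambda>i ys. ys ! (i + 2)) [0..<k] :: (nat list \<Rightarrow> nat) list"
  have "recursive_fun (Suc (Suc k)) (\<lambda>ys. c (map (\<lambda>g. g ys) ?gs))"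
    by (rule recursive_comp) (use assms in \<open>auto intro!: recursive_proj\<close>)
  then show ?thesis
    by (rule recursive_fun_cong) (auto intro!: arg_cong[where f = c] nth_equalityI)
qed

text \<open>\<open>prim_rec\<close> recurses on the head of the list. Composing it with
  \<open>m\<close> followed by the \<open>k\<close> projections gives a recursion whose length is
  itself computed from the parameters.\<close>

lemma recursive_rec_nat:
  assumes b: "recursive_fun k b"
    and g: "recursive_fun (Suc (Suc k)) (\<lambda>ys. g (ys ! 0) (ys ! 1) (drop 2 ys))"
    and m: "recursive_fun k m"
  shows "recursive_fun k (\<lambda>xs. rec_nat (b xs) (\<lambda>n r. g n r xs) (m xs))"
proof -
  obtain b' where b': "total_recursive k b'" "\<And>xs. length xs = k \<Longrightarrow> b' xs = b xs"
    using b unfolding recursive_fun_def by blast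
  obtain g' where g': "total_recursive (Suc (Suc k)) g'"
    "\<And>ys. length ys = Suc (Suc k) \<Longrightarrow> g' ys = g (ys ! 0) (ys ! 1) (drop 2 ys)"
    using g unfolding recursive_fun_def by blast
  have "rec_nat (b' xs) (\<lambda>n r. g' (n # r # xs)) j = rec_nat (b xs) (\<lambda>n r. g n r xs) j"
    if "length xs = k" for xs j
    by (induction j) (simp_all add: b'(2) g'(2) that)
  then have R: "recursive_fun (Suc k) (\<lambda>xs. rec_nat (b (tl xs)) (\<lambda>n r. g n r (tl xs)) (hd xs))"
    unfolding recursive_fun_def using total_recursive.prim_rec[OF b'(1) g'(1)] by fastforce
  let ?gs = "m # map (\<lambda>i xs. xs ! i) [0..<k]"
  have "recursive_fun k (\<lambda>xs. (\<lambda>xs. rec_nat (b (tl xs)) (\<lambda>n r. g n r (tl xs)) (hd xs))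
      (map (\<lambda>g. g xs) ?gs))"
    by (rule recursive_comp) (use R m in \<open>auto intro!: recursive_proj\<close>)
  then show ?thesis
  proof (rule recursive_fun_cong)
    fix xs :: "nat list" assume "length xs = k"
    then have "map (\<lambda>g. g xs) ?gs = m xs # xs"
      by (auto intro: nth_equalityI)
    then show "(\<lambda>xs. rec_nat (b (tl xs)) (\<lambda>n r. g n r (tl xs)) (hd xs)) (map (\<lambda>g. g xs) ?gs) =
        rec_nat (b xs) (\<lambda>n r. g n r xs) (m xs)"
      by simp
  qed
qed

text \<open>A recursion that returns \<open>b\<close> at zero and \<open>c\<close> after any
  positive number of steps is a case distinction.\<close>

lemma recursive_if_zero:
  assumes "recursive_fun k a" "recursive_fun k b" "recursive_fun k c"
  shows "recursive_fun k (\<lambda>xs. if a xs = 0 then b xs else c xs)"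
proof (rule recursive_fun_cong)
  show "recursive_fun k (\<lambda>xs. rec_nat (b xs) (\<lambda>n r. c xs) (a xs))"
    by (intro recursive_rec_nat recursive_drop2 assms)
  show "rec_nat (b xs) (\<lambda>n r. c xs) (a xs) = (if a xs = 0 then b xs else c xs)" for xs
    by (cases "a xs") auto
qed

lemma recursive_funpow:
  assumes f: "recursive_fun 1 (\<lambda>xs. f (xs ! 0))" and "recursive_fun k b" "recursive_fun k m"
  shows "recursive_fun k (\<lambda>xs. (f ^^ m xs) (b xs))"
proof (rule recursive_fun_cong)
  show "recursive_fun k (\<lambda>xs. rec_nat (b xs) (\<lambda>n r. f r) (m xs))"
    by (intro recursive_rec_nat recursive_comp1[OF f] recursive_proj assms) simp
  have "rec_nat s (\<lambda>n r. f r) j = (f ^^ j) s" for s j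
    by (induction j) auto
  then show "rec_nat (b xs) (\<lambda>n r. f r) (m xs) = (f ^^ m xs) (b xs)" for xs .
qed

lemma recursive_pred:
  assumes "recursive_fun k a"
  shows "recursive_fun k (\<lambda>xs. a xs - 1)"
proof (rule recursive_fun_cong)
  show "recursive_fun k (\<lambda>xs. rec_nat 0 (\<lambda>n r. n) (a xs))"
    by (intro recursive_rec_nat recursive_zero recursive_proj assms) simp
  show "rec_nat 0 (\<lambda>n r. n) (a xs) = a xs - 1" for xs
    by (cases "a xs") auto
qed

lemma recursive_add:
  assumes "recursive_fun k a" "recursive_fun k b"
  shows "recursive_fun k (\<lambda>xs. a xs + b xs)"
proof -
  have "recursive_fun k (\<lambda>xs. (Suc ^^ b xs) (a xs))"
    by (intro recursive_funpow recursive_Suc recursive_proj assms) simp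
  then show ?thesis
    by (simp add: add.commute)
qed

lemma recursive_diff:
  assumes "recursive_fun k a" "recursive_fun k b"
  shows "recursive_fun k (\<lambda>xs. a xs - b xs)"
proof (rule recursive_fun_cong)
  show "recursive_fun k (\<lambda>xs. ((\<lambda>n. n - 1) ^^ b xs) (a xs))"
    by (intro recursive_funpow recursive_pred recursive_proj assms) simp
  have "((\<lambda>n. n - 1) ^^ j) s = s - j" for s j :: nat
    by (induction j) auto
  then show "((\<lambda>n. n - 1) ^^ b xs) (a xs) = a xs - b xs" for xs .
qed

section \<open>Cantor pairing and its inverse\<close>

lemma recursive_triangle:
  assumes "recursive_fun k a"
  shows "recursive_fun k (\<lambda>xs. triangle (a xs))"
proof (rule recursive_fun_cong)
  show "recursive_fun k (\<lambda>xs. rec_nat 0 (\<lambda>n r. r + Suc n) (a xs))"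
    by (intro recursive_rec_nat recursive_add recursive_Suc recursive_zero recursive_proj assms)
      simp_all
  have "rec_nat 0 (\<lambda>n r. r + Suc n) j = triangle j" for j
    by (induction j) auto
  then show "rec_nat 0 (\<lambda>n r. r + Suc n) (a xs) = triangle (a xs)" for xs .
qed

lemma recursive_prod_encode:
  assumes "recursive_fun k a" "recursive_fun k b"
  shows "recursive_fun k (\<lambda>xs. prod_encode (a xs, b xs))"
  unfolding prod_encode_def prod.case
  by (intro recursive_add recursive_triangle assms)

lemma recursive_Least:
  assumes f: "recursive_fun (Suc k) f" and ex: "\<And>xs. length xs = k \<Longrightarrow> \<exists>n. f (n # xs) = 0"
  shows "recursive_fun k (\<lambda>xs. LEAST n. f (n # xs) = 0)"
proof -
  obtain f' where f': "total_recursive (Suc k) f'"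
    "\<And>xs. length xs = Suc k \<Longrightarrow> f' xs = f xs"
    using f unfolding recursive_fun_def by blast
  have "total_recursive k (\<lambda>xs. LEAST n. f' (n # xs) = 0)"
    by (rule total_recursive.minim) (use f' ex in auto)
  then show ?thesis
    unfolding recursive_fun_def by (intro exI conjI) (auto simp: f'(2))
qed

text \<open>The index of the antidiagonal on which the pair with code \<open>n\<close> lies.\<close>

definition antidiag :: "nat \<Rightarrow> nat" where
  "antidiag n = (LEAST i. Suc n - triangle (Suc i) = 0)"

text \<open>The codes of pairs with sum \<open>a + b\<close> run from
  \<open>triangle (a + b)\<close> up to, but excluding, \<open>triangle (Suc (a + b))\<close>. With
  truncated subtraction, the equation in \<open>antidiag\<close> says that the code is below
  \<open>triangle (Suc i)\<close>.\<close>

lemma antidiag_prod_encode: "antidiag (prod_encode (a, b)) = a + b"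
  unfolding antidiag_def
proof (rule Least_equality)
  show "Suc (prod_encode (a, b)) - triangle (Suc (a + b)) = 0"
    by (simp add: prod_encode_def)
  show "a + b \<le> i" if "Suc (prod_encode (a, b)) - triangle (Suc i) = 0" for i
  proof (rule ccontr)
    assume "\<not> a + b \<le> i"
    then have "Suc i \<le> a + b" by simp
    moreover have "mono triangle"
      unfolding mono_iff_le_Suc by simp
    ultimately have "triangle (Suc i) \<le> triangle (a + b)"
      by (rule monoD[rotated])
    then show False using that by (simp add: prod_encode_def)
  qed
qed

lemma recursive_antidiag:
  assumes "recursive_fun k a"
  shows "recursive_fun k (\<lambda>xs. antidiag (a xs))"
proof -
  have "recursive_fun (Suc 1) (\<lambda>ys. Suc (ys ! 1) - triangle (Suc (ys ! 0)))"
    by (intro recursive_diff recursive_Suc recursive_triangle recursive_proj) simp_all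
  then have "recursive_fun 1 (\<lambda>xs. LEAST i. Suc ((i # xs) ! 1) - triangle (Suc ((i # xs) ! 0)) = 0)"
  proof (rule recursive_Least)
    fix xs :: "nat list"
    \<comment> \<open>A code bounds the index of its own antidiagonal, so the search always
      succeeds.\<close>
    have "Suc (xs ! 0) - triangle (Suc (xs ! 0)) = 0" by simp
    then show "\<exists>n. Suc ((n # xs) ! 1) - triangle (Suc ((n # xs) ! 0)) = 0"
      by (metis One_nat_def nth_Cons_0 nth_Cons_Suc)
  qed
  then have "recursive_fun 1 (\<lambda>xs. antidiag (xs ! 0))"
    by (simp add: antidiag_def)
  then show ?thesis using assms by (rule recursive_comp1)
qed

text \<open>Since \<open>prod_encode (i, j)\<close> is \<open>triangle (i + j) + i\<close>, the
  first component is the offset of the code from the start of its antidiagonal.\<close>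

lemma recursive_fst_decode:
  assumes "recursive_fun k a"
  shows "recursive_fun k (\<lambda>xs. fst (prod_decode (a xs)))"
proof (rule recursive_fun_cong)
  show "recursive_fun k (\<lambda>xs. a xs - triangle (antidiag (a xs)))"
    by (intro recursive_diff recursive_triangle recursive_antidiag assms)
  have "n - triangle (antidiag n) = fst (prod_decode n)" for n
  proof -
    obtain i j where "n = prod_encode (i, j)" by (metis prod_decode_inverse surj_pair)
    then show ?thesis
      by (simp add: antidiag_prod_encode) (simp add: prod_encode_def)
  qed
  then show "a xs - triangle (antidiag (a xs)) = fst (prod_decode (a xs))" for xs .
qed

lemma recursive_snd_decode:
  assumes "recursive_fun k a"
  shows "recursive_fun k (\<lambda>xs. snd (prod_decode (a xs)))"
proof (rule recursive_fun_cong)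
  show "recursive_fun k (\<lambda>xs. antidiag (a xs) - fst (prod_decode (a xs)))"
    by (intro recursive_diff recursive_fst_decode recursive_antidiag assms)
  have "antidiag n - fst (prod_decode n) = snd (prod_decode n)" for n
  proof -
    obtain i j where "n = prod_encode (i, j)" by (metis prod_decode_inverse surj_pair)
    then show ?thesis by (simp add: antidiag_prod_encode)
  qed
  then show "antidiag (a xs) - fst (prod_decode (a xs)) = snd (prod_decode (a xs))" for xs .
qed

text \<open>One step of the loop that moves the elements of a list to an accumulator.  Since
  descriptions may list graphs in any order, the list need not be reversed again.\<close>

definition move_step :: "(nat \<Rightarrow> nat) \<Rightarrow> nat \<Rightarrow> nat" where
  "move_step f s =
     (let r = fst (prod_decode s); x = prod_decode (r - 1) in
      if r = 0 then s
      else prod_encode (snd x, Suc (prod_encode (f (fst x), snd (prod_decode s)))))"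

text \<open>The code of a list is at least its length, so it can serve as the number of steps;
  surplus steps leave the final state fixed. The accumulator starts with \<open>0\<close>, the code
  of the empty list.\<close>

definition rev_map_code :: "(nat \<Rightarrow> nat) \<Rightarrow> nat \<Rightarrow> nat" where
  "rev_map_code f n = snd (prod_decode ((move_step f ^^ n) (prod_encode (n, 0))))"

text \<open>The accumulator \<open>ys\<close> is general to carry the induction on
  \<open>m\<close>.\<close>

lemma funpow_move_step:
  assumes "length xs \<le> m"
  shows "(move_step f ^^ m) (prod_encode (list_encode xs, list_encode ys)) =
    prod_encode (0, list_encode (rev (map f xs) @ ys))"
  using assms
proof (induction m arbitrary: xs ys)
  case 0
  then show ?case by simp
next
  case (Suc m)
  show ?case
  proof (cases xs)
    case Nil
    then have "move_step f (prod_encode (list_encode xs, list_encode ys)) =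
        prod_encode (list_encode [], list_encode ys)"
      by (simp add: move_step_def)
    then show ?thesis
      using Suc.IH[of "[]" ys] by (simp add: funpow_Suc_right Nil del: funpow.simps)
  next
    case (Cons x xs')
    then have "move_step f (prod_encode (list_encode xs, list_encode ys)) =
        prod_encode (list_encode xs', list_encode (f x # ys))"
      by (simp add: move_step_def)
    then show ?thesis
      using Suc.IH[of xs' "f x # ys"] Suc.prems Cons
      by (simp add: funpow_Suc_right del: funpow.simps list_encode.simps)
  qed
qed

lemma length_le_list_encode: "length xs \<le> list_encode xs"
  by (induction xs) (auto intro: order_trans[OF _ le_prod_encode_2])

lemma rev_map_code_list_encode: "rev_map_code f (list_encode xs) = list_encode (rev (map f xs))"
  using funpow_move_step[OF length_le_list_encode, of xs f "[]"] by (simp add: rev_map_code_def)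

lemma recursive_rev_map_code:
  assumes f: "recursive_fun 1 (\<lambda>xs. f (xs ! 0))" and a: "recursive_fun k a"
  shows "recursive_fun k (\<lambda>xs. rev_map_code f (a xs))"
proof -
  have "recursive_fun 1 (\<lambda>xs. move_step f (xs ! 0))"
    unfolding move_step_def Let_def
    by (intro recursive_if_zero recursive_prod_encode recursive_Suc recursive_fst_decode
        recursive_snd_decode recursive_pred recursive_comp1[OF f] recursive_proj) simp_all
  then show ?thesis
    unfolding rev_map_code_def
    by (intro recursive_snd_decode recursive_funpow recursive_prod_encode recursive_zero a)
qed

lemma computable_if_recursive: "recursive_fun 1 (\<lambda>xs. h (xs ! 0)) \<Longrightarrow> computable h"
  unfolding recursive_fun_def computable_def by fastforce

section \<open>The uniform measure on configurations\<close>

lemma shift_assoc: "shift (shift z x) v = shift z (shift x v)"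
  unfolding shift_def by (rule nth_equalityI) (auto simp: add.assoc)

locale uniform_configs =
  fixes d :: nat and Q :: "'q set"
  assumes fin: "finite Q" and ne: "Q \<noteq> {}"
begin

abbreviation "\<mu> \<equiv> uniform_config_measure d Q"

sublocale U: prob_space "uniform_count_measure Q"
  by (rule prob_space_uniform_count_measure) (fact fin ne)+

sublocale prob_space \<mu>
  unfolding uniform_config_measure_def by (intro prob_space_PiM U.prob_space_axioms)

lemma space_uniform: "space \<mu> = configs d Q"
  by (simp add: uniform_config_measure_def configs_def space_PiM space_uniform_count_measure)

lemma sets_uniform: "sets \<mu> = sets (config_algebra d Q)"
  unfolding uniform_config_measure_def config_algebra_def
  by (intro sets_PiM_cong) (auto simp: sets_uniform_count_measure)

lemma configs_nonempty: "configs d Q \<noteq> {}"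
  using ne by (auto simp: configs_def PiE_eq_empty_iff)

section \<open>Events determined by finitely many cells, that is, finite unions of cylinders\<close>

definition determined :: "int list set \<Rightarrow> (int list \<Rightarrow> 'q) set \<Rightarrow> bool" where
  "determined E X \<longleftrightarrow> X \<subseteq> configs d Q \<and>
     (\<forall>s\<in>X. \<forall>s'\<in>configs d Q. (\<forall>z\<in>E. s z = s' z) \<longrightarrow> s' \<in> X)"

lemma determined_mono: "determined E X \<Longrightarrow> E \<subseteq> E' \<Longrightarrow> determined E' X"
  unfolding determined_def by blast

lemma determined_compl: "determined E X \<Longrightarrow> determined E (configs d Q - X)"
  unfolding determined_def by (simp add: Ball_def) metis

lemma determined_Inter:
  "J \<noteq> {} \<Longrightarrow> (\<And>j. j \<in> J \<Longrightarrow> determined E (X j)) \<Longrightarrow> determined E (\<Inter>j\<in>J. X j)"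
  unfolding determined_def by (simp add: Ball_def) blast

abbreviation patterns :: "int list set \<Rightarrow> (int list \<Rightarrow> 'q) set \<Rightarrow> (int list \<Rightarrow> 'q) set" where
  "patterns E X \<equiv> (\<lambda>s. restrict s E) ` X"

lemma patterns_subset: "X \<subseteq> configs d Q \<Longrightarrow> E \<subseteq> cells d \<Longrightarrow> patterns E X \<subseteq> E \<rightarrow>\<^sub>E Q"
  by (fastforce simp: configs_def)

text \<open>This presents a determined event as an event about the restriction to \<open>E\<close>,
  the form in which measurability and independence of restrictions apply.\<close>

lemma determined_eq_vimage:
  assumes "determined E X"
  shows "X = (\<lambda>s. restrict s E) -` patterns E X \<inter> space \<mu>"
proof (intro equalityI subsetI IntI vimageI2 imageI)
  show "s \<in> space \<mu>" if "s \<in> X" for s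
    using assms that by (auto simp: determined_def space_uniform)
  show "s \<in> X" if s: "s \<in> (\<lambda>s. restrict s E) -` patterns E X \<inter> space \<mu>" for s
  proof -
    obtain t where t: "t \<in> X" "restrict s E = restrict t E" using s by blast
    have "\<forall>z\<in>E. t z = s z"
    proof
      fix z assume "z \<in> E"
      then show "t z = s z" using fun_cong[OF t(2), of z] by simp
    qed
    then show ?thesis
      using assms t(1) s unfolding determined_def space_uniform by blast
  qed
qed

lemma finite_PiE_pattern: "finite E \<Longrightarrow> finite (E \<rightarrow>\<^sub>E Q)"
  by (intro finite_PiE) (auto simp: fin)

lemma pattern_in_sets:
  assumes "finite E" "P \<subseteq> E \<rightarrow>\<^sub>E Q"
  shows "P \<in> sets (\<Pi>\<^sub>M z\<in>E. uniform_count_measure Q)"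
proof -
  have "{p} \<in> sets (\<Pi>\<^sub>M z\<in>E. uniform_count_measure Q)" if "p \<in> P" for p
  proof -
    have "{p} = Pi\<^sub>E E (\<lambda>z. {p z})"
      using that assms by (intro PiE_singleton[symmetric]) (auto simp: PiE_def)
    then show ?thesis
      using that assms(1) PiE_mem[OF subsetD[OF assms(2) that]]
      by (auto simp: sets_uniform_count_measure intro!: sets_PiM_I_finite)
  qed
  moreover have "finite P" using finite_subset[OF assms(2) finite_PiE_pattern[OF assms(1)]] .
  ultimately show ?thesis
    using sets.finite_UN[of P "\<lambda>p. {p}"] by simp
qed

lemma measurable_restrict_uniform:
  "E \<subseteq> cells d \<Longrightarrow>
    (\<lambda>s. restrict s E) \<in> \<mu> \<rightarrow>\<^sub>M (\<Pi>\<^sub>M z\<in>E. uniform_count_measure Q)"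
  unfolding uniform_config_measure_def by (rule measurable_restrict_subset)

lemma determined_in_sets:
  assumes "determined E X" "finite E" "E \<subseteq> cells d"
  shows "X \<in> sets \<mu>"
proof -
  have "patterns E X \<in> sets (\<Pi>\<^sub>M z\<in>E. uniform_count_measure Q)"
    using assms by (intro pattern_in_sets patterns_subset) (auto simp: determined_def)
  then have "(\<lambda>s. restrict s E) -` patterns E X \<inter> space \<mu> \<in> sets \<mu>"
    by (rule measurable_sets[OF measurable_restrict_uniform[OF assms(3)]])
  then show ?thesis using determined_eq_vimage[OF assms(1)] by simp
qed

text \<open>The event is the disjoint union of the cylinders of its patterns on \<open>E\<close>,
  and each of them has probability \<open>1 / card Q ^ card E\<close>. Probabilities thereby become
  pattern counts.\<close>

lemma prob_determined:
  assumes X: "determined E X" and E: "finite E" "E \<subseteq> cells d"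
  shows "prob X = card (patterns E X) / card Q ^ card E"
proof -
  let ?P = "patterns E X" and ?c = "\<lambda>p. (\<lambda>s. restrict s E) -` {p} \<inter> space \<mu>"
  have P: "?P \<subseteq> E \<rightarrow>\<^sub>E Q"
    using X E by (intro patterns_subset) (auto simp: determined_def)
  have fP: "finite ?P" using finite_subset[OF P finite_PiE_pattern[OF E(1)]] .
  have meas: "?c p \<in> sets \<mu>" if "p \<in> ?P" for p
    by (rule measurable_sets[OF measurable_restrict_uniform[OF E(2)]])
      (use that P E in \<open>auto intro: pattern_in_sets\<close>)
  have c: "prob (?c p) = 1 / card Q ^ card E" if "p \<in> ?P" for p
  proof -
    have p: "p \<in> E \<rightarrow>\<^sub>E Q" using that P by blast
    then have "{p} = Pi\<^sub>E E (\<lambda>z. {p z})"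
      by (intro PiE_singleton[symmetric]) (auto simp: PiE_def)
    then have "?c p = prod_emb (cells d) (\<lambda>_. uniform_count_measure Q) E (Pi\<^sub>E E (\<lambda>z. {p z}))"
      by (auto simp: prod_emb_def space_uniform configs_def space_PiM space_uniform_count_measure)
    moreover have "emeasure \<mu> (prod_emb (cells d) (\<lambda>_. uniform_count_measure Q) E
        (Pi\<^sub>E E (\<lambda>z. {p z}))) = (\<Prod>z\<in>E. emeasure (uniform_count_measure Q) {p z})"
      unfolding uniform_config_measure_def using E p
      by (intro emeasure_PiM_emb U.prob_space_axioms) (auto simp: sets_uniform_count_measure)
    moreover have "\<dots> = (\<Prod>z\<in>E. ennreal (1 / card Q))"
      using PiE_mem[OF p] by (intro prod.cong refl)
        (simp add: emeasure_uniform_count_measure[OF fin])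
    moreover have "\<dots> = ennreal ((1 / card Q) ^ card E)"
      by (simp add: ennreal_power)
    ultimately have "emeasure \<mu> (?c p) = ennreal ((1 / card Q) ^ card E)" by simp
    then show ?thesis by (simp add: measure_def power_one_over)
  qed
  have "X = (\<Union>p\<in>?P. ?c p)"
    using determined_eq_vimage[OF X] by blast
  then have "prob X = prob (\<Union>p\<in>?P. ?c p)" by (rule arg_cong)
  also have "\<dots> = (\<Sum>p\<in>?P. prob (?c p))"
    using fP meas by (intro finite_measure_finite_Union) (auto simp: disjoint_family_on_def)
  also have "\<dots> = card ?P / card Q ^ card E"
    using c by simp
  finally show ?thesis .
qed

section \<open>Independence of disjoint blocks and translation invariance\<close>

lemma indep_coordinates: "indep_vars (\<lambda>_. uniform_count_measure Q) (\<lambda>z s. s z) (cells d)"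
proof (subst indep_vars_iff_distr_eq_PiM')
  show "cells d \<noteq> {}" unfolding cells_def using Ex_list_of_length by auto
  show "(\<lambda>s. s z) \<in> \<mu> \<rightarrow>\<^sub>M uniform_count_measure Q" if "z \<in> cells d" for z
    unfolding uniform_config_measure_def using that by measurable
  \<comment> \<open>All coordinates together form the identity on configurations, so their joint law
    is \<mu>, which is the product of its one-cell marginals.\<close>
  have "distr \<mu> (\<Pi>\<^sub>M z\<in>cells d. uniform_count_measure Q) (\<lambda>s. \<lambda>z\<in>cells d. s z) =
      distr \<mu> \<mu> (\<lambda>s. s)"
    by (intro distr_cong)
      (auto simp: uniform_config_measure_def space_PiM PiE_iff fun_eq_iff extensional_def)
  also have "\<dots> = \<mu>" by (rule distr_id)
  also have "\<mu> = (\<Pi>\<^sub>M z\<in>cells d. distr \<mu> (uniform_count_measure Q) (\<lambda>s. s z))"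
    unfolding uniform_config_measure_def
    by (intro PiM_cong distr_PiM_component[symmetric] U.prob_space_axioms refl)
  finally show "distr \<mu> (\<Pi>\<^sub>M z\<in>cells d. uniform_count_measure Q) (\<lambda>s. \<lambda>z\<in>cells d. s z) =
      (\<Pi>\<^sub>M z\<in>cells d. distr \<mu> (uniform_count_measure Q) (\<lambda>s. s z))" .
qed

lemma prob_Inter_determined:
  assumes J: "finite J" "J \<noteq> {}" and disj: "disjoint_family_on E J"
    and X: "\<And>j. j \<in> J \<Longrightarrow> determined (E j) (X j)"
    and E: "\<And>j. j \<in> J \<Longrightarrow> finite (E j)" "\<And>j. j \<in> J \<Longrightarrow> E j \<subseteq> cells d"
  shows "prob (\<Inter>j\<in>J. X j) = (\<Prod>j\<in>J. prob (X j))"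
proof -
  have "indep_vars (\<lambda>j. \<Pi>\<^sub>M z\<in>E j. uniform_count_measure Q) (\<lambda>j s. restrict s (E j)) J"
    using indep_vars_restrict[OF indep_coordinates E(2) disj] by simp
  then have "prob (\<Inter>j\<in>J. (\<lambda>s. restrict s (E j)) -` patterns (E j) (X j) \<inter> space \<mu>) =
      (\<Prod>j\<in>J. prob ((\<lambda>s. restrict s (E j)) -` patterns (E j) (X j) \<inter> space \<mu>))"
  proof (rule indep_varsD_finite)
    show "patterns (E j) (X j) \<in> sets (\<Pi>\<^sub>M z\<in>E j. uniform_count_measure Q)" if "j \<in> J" for j
      using X[OF that] E that by (intro pattern_in_sets patterns_subset) (auto simp: determined_def)
  qed (use J in auto)
  moreover have "(\<lambda>s. restrict s (E j)) -` patterns (E j) (X j) \<inter> space \<mu> = X j" if "j \<in> J" for j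
    using determined_eq_vimage[OF X[OF that]] by simp
  ultimately show ?thesis by simp
qed

definition translate :: "int list \<Rightarrow> (int list \<Rightarrow> 'q) \<Rightarrow> int list \<Rightarrow> 'q" where
  "translate z s = (\<lambda>x\<in>cells d. s (shift z x))"

lemma translate_in_configs: "z \<in> cells d \<Longrightarrow> s \<in> configs d Q \<Longrightarrow> translate z s \<in> configs d Q"
  unfolding translate_def configs_def by (simp add: restrict_PiE_iff PiE_iff shift_in_cells)

lemma inj_on_shift: "z \<in> cells d \<Longrightarrow> inj_on (shift z) (cells d)"
  by (rule inj_onI) (simp add: shift_def cells_def list_eq_iff_nth_eq)

text \<open>A translation reindexes the coordinates injectively, and all factors of the product
  measure are equal.\<close>

lemma prob_translate:
  assumes z: "z \<in> cells d" and X: "X \<in> sets \<mu>"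
  shows "prob (translate z -` X \<inter> configs d Q) = prob X"
proof -
  have "distr \<mu> \<mu> (translate z) = \<mu>"
    unfolding uniform_config_measure_def translate_def
    by (rule distr_PiM_reindex[OF U.prob_space_axioms inj_on_shift[OF z]])
      (use z in \<open>auto intro: shift_in_cells\<close>)
  moreover have "translate z \<in> \<mu> \<rightarrow>\<^sub>M \<mu>"
    unfolding translate_def uniform_config_measure_def
    by (intro measurable_restrict measurable_component_singleton shift_in_cells z)
  ultimately show ?thesis
    using measure_distr[of "translate z" \<mu> \<mu> X] X by (simp add: space_uniform)
qed

lemma determined_translate:
  assumes X: "determined E X" and z: "z \<in> cells d" and E: "E \<subseteq> cells d"
  shows "determined (shift z ` E) (translate z -` X \<inter> configs d Q)"
  unfolding determined_def
proof (intro conjI ballI impI IntI vimageI2)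
  fix s s' assume s: "s \<in> translate z -` X \<inter> configs d Q" and s': "s' \<in> configs d Q"
    and eq: "\<forall>x\<in>shift z ` E. s x = s' x"
  have "\<forall>x\<in>E. translate z s x = translate z s' x"
    using eq E by (auto simp: translate_def)
  moreover have "translate z s \<in> X"
    using s by simp
  ultimately show "translate z s' \<in> X"
    using X translate_in_configs[OF z s'] unfolding determined_def by blast
qed auto

end

section \<open>Surjectivity and preservation of the uniform measure\<close>

text \<open>Taking logarithms and dividing by \<open>m ^ d\<close> bounds \<open>ln y - ln x\<close>
  by a constant times \<open>(1 + 1 / m) ^ d - 1\<close>, which tends to zero. In the application
  \<open>k\<close> is the number of states, and the exponents of \<open>k\<close> are the volumes of
  a tiled cube and of its enlargement.\<close>

lemma power_le_imp_le_boundary: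
  fixes x y k :: real
  assumes x: "x \<ge> 0" and k: "k \<ge> 1"
    and le: "\<And>m. m \<ge> 1 \<Longrightarrow>
      y ^ (m ^ d) * k ^ (N ^ d * m ^ d) \<le> x ^ (m ^ d) * k ^ (N ^ d * (m + 1) ^ d)"
  shows "y \<le> x"
proof (rule ccontr)
  assume "\<not> y \<le> x"
  then have xy: "x < y" and y: "y > 0" using x by auto
  \<comment> \<open>The logarithm of \<open>x\<close> is only meaningful for positive
    \<open>x\<close>; the case \<open>m = 1\<close> excludes zero.\<close>
  have x0: "x > 0"
  proof (rule ccontr)
    assume "\<not> x > 0"
    then have "y * k ^ (N ^ d) \<le> 0" using le[of 1] x by simp
    moreover have "y * k ^ (N ^ d) > 0" using y k by simp
    ultimately show False by linarith
  qed
  have bound: "ln y - ln x \<le> N ^ d * ln k * ((1 + 1 / m) ^ d - 1)" if m: "m \<ge> 1" for m :: nat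
  proof -
    have "ln (y ^ (m ^ d) * k ^ (N ^ d * m ^ d)) \<le> ln (x ^ (m ^ d) * k ^ (N ^ d * (m + 1) ^ d))"
      using le[OF m] y k by (intro ln_mono) auto
    then have "m ^ d * ln y + N ^ d * m ^ d * ln k \<le> m ^ d * ln x + N ^ d * (m + 1) ^ d * ln k"
      using x0 y k by (simp add: ln_mult ln_realpow)
    then have "real m ^ d * (ln y - ln x) \<le> real N ^ d * ln k * (real (m + 1) ^ d - real m ^ d)"
      by (simp add: algebra_simps)
    also have "\<dots> = real m ^ d * (N ^ d * ln k * ((1 + 1 / m) ^ d - 1))"
    proof -
      have "real (m + 1) = m * (1 + 1 / m)"
        using m by (simp add: field_simps)
      then have "real (m + 1) ^ d = real m ^ d * (1 + 1 / m) ^ d"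
        by (simp only: power_mult_distrib)
      then show ?thesis by (simp only:) (simp add: algebra_simps)
    qed
    finally show ?thesis using m by simp
  qed
  have "(\<lambda>m. N ^ d * ln k * ((1 + 1 / real m) ^ d - 1)) \<longlonglongrightarrow> N ^ d * ln k * ((1 + 0) ^ d - 1)"
    by (intro tendsto_intros lim_1_over_n)
  then have "ln y - ln x \<le> N ^ d * ln k * ((1 + 0) ^ d - 1)"
    by (rule LIMSEQ_le_const) (use bound in \<open>auto intro!: exI[of _ 1]\<close>)
  then show False using xy x0 by simp
qed

section \<open>Cubes in the lattice\<close>

definition window :: "nat \<Rightarrow> int \<Rightarrow> int \<Rightarrow> int list set" where
  "window d a b = {z. set z \<subseteq> {a..<b} \<and> length z = d}"

lemma card_window: "card (window d a b) = nat (b - a) ^ d"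
  unfolding window_def by (subst card_lists_length_eq) auto

lemma finite_window: "finite (window d a b)"
  unfolding window_def by (rule finite_lists_length_eq) simp

lemma window_subset_cells: "window d a b \<subseteq> cells d"
  by (auto simp: window_def cells_def)

lemma mem_window_iff: "z \<in> window d a b \<longleftrightarrow> length z = d \<and> (\<forall>i<d. a \<le> z ! i \<and> z ! i < b)"
  by (auto simp: window_def subset_iff in_set_conv_nth)

lemma shift_in_window:
  "z \<in> window d a b \<Longrightarrow> v \<in> window d (- R) R \<Longrightarrow> shift z v \<in> window d (a - R) (b + R)"
  by (fastforce simp: mem_window_iff shift_def)

lemma nth_shift: "n < length z \<Longrightarrow> n < length v \<Longrightarrow> shift z v ! n = z ! n + v ! n"
  by (simp add: shift_def)

lemma finite_subset_window:
  assumes "finite E" "E \<subseteq> cells d"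
  obtains R where "R > 0" "E \<subseteq> window d (- R) R"
proof -
  let ?S = "abs ` (\<Union>z\<in>E. set z)"
  have fin: "finite (insert 0 ?S)" using assms by auto
  \<comment> \<open>The inserted \<open>0\<close> keeps the set nonempty; adding \<open>1\<close>
    makes \<open>R\<close> positive and accounts for the open right end of the window.\<close>
  define R where "R = Max (insert 0 ?S) + 1"
  have "R > 0" using Max_ge[OF fin, of 0] by (simp add: R_def)
  moreover have "- R \<le> z ! i \<and> z ! i < R" if "z \<in> E" "i < length z" for z i
  proof -
    have "\<bar>z ! i\<bar> \<in> insert 0 ?S" using that nth_mem by blast
    then have "\<bar>z ! i\<bar> \<le> Max (insert 0 ?S)" by (rule Max_ge[OF fin])
    then show ?thesis unfolding R_def by linarith
  qed
  then have "E \<subseteq> window d (- R) R"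
    using assms(2) unfolding mem_window_iff cells_def subset_iff by auto
  ultimately show ?thesis using that by blast
qed

section \<open>Global maps of classical automata\<close>

locale classical_automaton =
  fixes d :: nat and A :: "'q classical_ca"
  assumes ca: "is_ca d A"
begin

sublocale uniform_configs d "ca_states A"
  by unfold_locales (use ca in \<open>auto simp: is_ca_def\<close>)

abbreviation "Q \<equiv> ca_states A"
abbreviation "F \<equiv> ca_global d A"

lemma nbhd_cells: "set (ca_nbhd A) \<subseteq> cells d"
  using ca by (simp add: is_ca_def is_nbhd_def)

lemma global_in_configs:
  assumes s: "s \<in> configs d Q"
  shows "F s \<in> configs d Q"
proof -
  have "ca_local_fun A (map (\<lambda>v. s (shift z v)) (ca_nbhd A)) \<in> Q" if "z \<in> cells d" for z
  proof -
    have "s (shift z v) \<in> Q" if "v \<in> set (ca_nbhd A)" for v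
      using s shift_in_cells[OF \<open>z \<in> cells d\<close>] that nbhd_cells by (auto simp: configs_def)
    then have "map (\<lambda>v. s (shift z v)) (ca_nbhd A) \<in> tuples Q (length (ca_nbhd A))"
      by (auto simp: tuples_def)
    then show ?thesis using ca by (auto simp: is_ca_def)
  qed
  then show ?thesis by (simp add: ca_global_def configs_def)
qed

lemma global_cong:
  assumes "\<And>v. v \<in> set (ca_nbhd A) \<Longrightarrow> s (shift z v) = s' (shift z v)"
  shows "F s z = F s' z"
proof -
  have eq: "map (\<lambda>v. s (shift z v)) (ca_nbhd A) = map (\<lambda>v. s' (shift z v)) (ca_nbhd A)"
    using assms by simp
  show ?thesis by (simp add: ca_global_def restrict_def eq del: map_eq_conv)
qed

text \<open>The same local rule acts at every cell, and by associativity of \<open>shift\<close> the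
  neighbourhood is read equally before and after a translation.\<close>

lemma global_translate:
  assumes z: "z \<in> cells d"
  shows "F (translate z s) = translate z (F s)"
proof
  fix x
  have eq: "map (\<lambda>v. translate z s (shift x v)) (ca_nbhd A) =
      map (\<lambda>v. s (shift (shift z x) v)) (ca_nbhd A)" if "x \<in> cells d"
    using that nbhd_cells by (auto simp: translate_def shift_assoc shift_in_cells)
  show "F (translate z s) x = translate z (F s) x"
  proof (cases "x \<in> cells d")
    case True
    then have "F (translate z s) x =
        ca_local_fun A (map (\<lambda>v. translate z s (shift x v)) (ca_nbhd A))"
      by (simp add: ca_global_def)
    then show ?thesis
      using True z by (simp only: eq) (simp add: ca_global_def translate_def shift_in_cells)
  qed (simp add: ca_global_def translate_def)
qed

lemma determined_vimage_global:
  assumes X: "determined B X"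
    and B': "\<And>z v. z \<in> B \<Longrightarrow> v \<in> set (ca_nbhd A) \<Longrightarrow> shift z v \<in> B'"
  shows "determined B' (F -` X \<inter> configs d Q)"
  unfolding determined_def
proof (intro conjI ballI impI IntI vimageI2)
  fix s s' assume s: "s \<in> F -` X \<inter> configs d Q" and s': "s' \<in> configs d Q"
    and eq: "\<forall>z\<in>B'. s z = s' z"
  have "\<forall>z\<in>B. F s z = F s' z"
    using eq B' by (intro ballI global_cong) blast
  moreover have "F s \<in> X" using s by blast
  ultimately show "F s' \<in> X"
    using X global_in_configs[OF s'] unfolding determined_def by blast
qed auto

text \<open>Each pattern of \<open>X\<close> on \<open>B\<close> extends to a configuration in
  \<open>X\<close>, which has a preimage by surjectivity. The restriction of that preimage to
  \<open>B'\<close> determines the pattern on \<open>B\<close>, so the preimage of \<open>X\<close>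
  has at least as many patterns on \<open>B'\<close> as \<open>X\<close> has on \<open>B\<close>.
  Both sides of the inequality are these counts.\<close>

lemma surjective_prob_bound:
  assumes surj: "ca_surjective d A" and X: "determined B X"
    and B: "finite B" "B \<subseteq> cells d" and B': "finite B'" "B' \<subseteq> cells d"
    and nb: "\<And>z v. z \<in> B \<Longrightarrow> v \<in> set (ca_nbhd A) \<Longrightarrow> shift z v \<in> B'"
  shows "prob X * card Q ^ card B \<le> prob (F -` X \<inter> configs d Q) * card Q ^ card B'"
proof -
  let ?Y = "F -` X \<inter> configs d Q"
  have Y: "determined B' ?Y" using X nb by (rule determined_vimage_global)
  have pos: "real (card Q) > 0" using fin ne by (simp add: card_gt_0_iff)
  have "\<exists>s. s \<in> ?Y \<and> restrict (F s) B = p" if p: "p \<in> patterns B X" for p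
  proof -
    obtain t where t: "t \<in> X" "p = restrict t B" using p by blast
    then have "t \<in> F ` configs d Q"
      using surj X by (auto simp: ca_surjective_def determined_def)
    then show ?thesis using t by blast
  qed
  then obtain g where g: "\<And>p. p \<in> patterns B X \<Longrightarrow> g p \<in> ?Y \<and> restrict (F (g p)) B = p"
    by metis
  have "inj_on (\<lambda>p. restrict (g p) B') (patterns B X)"
  proof (rule inj_onI)
    fix p q assume p: "p \<in> patterns B X" and q: "q \<in> patterns B X"
      and eq: "restrict (g p) B' = restrict (g q) B'"
    have "g p z = g q z" if "z \<in> B'" for z
      using fun_cong[OF eq, of z] that by simp
    then have "restrict (F (g p)) B = restrict (F (g q)) B"
      using nb by (intro restrict_ext global_cong) blast
    then show "p = q" using g[OF p] g[OF q] by simp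
  qed
  moreover have "(\<lambda>p. restrict (g p) B') ` patterns B X \<subseteq> patterns B' ?Y"
    using g by blast
  moreover have "finite (patterns B' ?Y)"
    using B' by (intro finite_subset[OF patterns_subset finite_PiE_pattern]) auto
  ultimately have "card (patterns B X) \<le> card (patterns B' ?Y)"
    by (rule card_inj_on_le)
  then show ?thesis
    using pos by (simp add: prob_determined[OF X B] prob_determined[OF Y B'])
qed

text \<open>A tiling argument: a deficit \<open>\<mu> (F -` X) < \<mu> X\<close> would multiply over \<open>m ^ d\<close> disjoint
  translates of the window, whereas for a surjective map the total loss is only exponential in the
  size of the boundary of the tiled cube, which has order \<open>m ^ (d - 1)\<close>.\<close>

lemma surjective_prob_le:
  assumes surj: "ca_surjective d A" and R: "R > 0"
    and X: "determined (window d (- R) R) X"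
    and Y: "determined (window d (- R) R) (F -` X \<inter> configs d Q)"
    and V: "set (ca_nbhd A) \<subseteq> window d (- R) R"
  shows "prob X \<le> prob (F -` X \<inter> configs d Q)"
proof (rule power_le_imp_le_boundary[where k = "real (card Q)" and d = d and N = "nat (2 * R)"])
  let ?E = "window d (- R) R"
  show "prob (F -` X \<inter> configs d Q) \<ge> 0" by simp
  show "1 \<le> real (card Q)" using fin ne by (simp add: Suc_leI card_gt_0_iff)
  fix m :: nat assume m: "m \<ge> 1"
  \<comment> \<open>\<open>J\<close> indexes \<open>m ^ d\<close> tiles. The window has side
    \<open>2 * R\<close>, so moving it by \<open>2 * R * j\<close> gives adjacent tiles that fill a
    cube of side \<open>2 * R * m\<close>.\<close>
  define J where "J = window d 0 (int m)"
  define c where "c = map ((*) (2 * R))"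
  have J: "finite J" "J \<noteq> {}" "card J = m ^ d"
    using m card_window[of d 0 "int m"] finite_window by (auto simp: J_def)
  have c_cells: "c j \<in> cells d" if "j \<in> J" for j
    using that by (simp add: J_def c_def mem_window_iff cells_def)
  have disj: "disjoint_family_on (\<lambda>j. shift (c j) ` ?E) J"
    unfolding disjoint_family_on_def
  proof (intro ballI impI equals0I)
    fix i j z assume i: "i \<in> J" and j: "j \<in> J" and "i \<noteq> j"
      and z: "z \<in> shift (c i) ` ?E \<inter> shift (c j) ` ?E"
    obtain x y where x: "x \<in> ?E" "z = shift (c i) x" and y: "y \<in> ?E" "z = shift (c j) y"
      using z by blast
    \<comment> \<open>Two offsets inside the window differ by less than \<open>2 * R\<close> in each
      coordinate, whereas the shifts of the tiles differ by multiples of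
      \<open>2 * R\<close>.\<close>
    have "i ! n = j ! n" if n: "n < d" for n
    proof -
      have len: "n < length i" "n < length j" "n < length x" "n < length y"
        using i j x y n by (simp_all add: J_def mem_window_iff)
      have "shift (c i) x ! n = 2 * R * i ! n + x ! n" "shift (c j) y ! n = 2 * R * j ! n + y ! n"
        using len by (simp_all add: nth_shift c_def)
      then have "2 * R * (i ! n - j ! n) = y ! n - x ! n"
        using x(2) y(2) by (simp add: algebra_simps)
      moreover have "- R \<le> x ! n" "x ! n < R" "- R \<le> y ! n" "y ! n < R"
        using x(1) y(1) n by (simp_all add: mem_window_iff)
      then have "\<bar>y ! n - x ! n\<bar> < 2 * R" by linarith
      ultimately have "\<bar>2 * R * (i ! n - j ! n)\<bar> < 2 * R * 1" by simp
      then have "2 * R * \<bar>i ! n - j ! n\<bar> < 2 * R * 1"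
        using R by (simp add: abs_mult)
      then have "\<bar>i ! n - j ! n\<bar> < 1" using R by (subst (asm) mult_less_cancel_left_pos) auto
      then show ?thesis by simp
    qed
    then show False
      using \<open>i \<noteq> j\<close> i j by (auto simp: J_def mem_window_iff list_eq_iff_nth_eq)
  qed
  have cube: "shift (c j) ` ?E \<subseteq> window d (- R) (2 * R * m - R)" if "j \<in> J" for j
  proof
    fix z assume "z \<in> shift (c j) ` ?E"
    then obtain x where x: "x \<in> ?E" "z = shift (c j) x" by blast
    have "- R \<le> z ! n \<and> z ! n < 2 * R * m - R" if n: "n < d" for n
    proof -
      have "z ! n = 2 * R * j ! n + x ! n" "0 \<le> j ! n" "j ! n \<le> int m - 1" "- R \<le> x ! n" "x ! n < R"
        using x \<open>j \<in> J\<close> n by (simp_all add: J_def c_def mem_window_iff nth_shift)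
      moreover from this have "0 \<le> 2 * R * j ! n" "2 * R * j ! n \<le> 2 * R * (int m - 1)"
        using R by (simp_all add: mult_left_mono)
      moreover have "2 * R * (int m - 1) = 2 * R * int m - 2 * R" by (simp add: algebra_simps)
      ultimately show ?thesis by linarith
    qed
    moreover have "length z = d"
      using x \<open>j \<in> J\<close> by (auto simp: J_def c_def mem_window_iff shift_def)
    ultimately show "z \<in> window d (- R) (2 * R * m - R)" by (simp add: mem_window_iff)
  qed
  \<comment> \<open>Disjoint tiles give independent events, and each translate has the probability
    of \<open>Z\<close>.\<close>
  have tiles: "prob (\<Inter>j\<in>J. translate (c j) -` Z \<inter> configs d Q) = prob Z ^ (m ^ d)"
    if Z: "determined ?E Z" for Z
  proof -
    have "prob (\<Inter>j\<in>J. translate (c j) -` Z \<inter> configs d Q) =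
        (\<Prod>j\<in>J. prob (translate (c j) -` Z \<inter> configs d Q))"
      using finite_window cube window_subset_cells c_cells
      by (intro prob_Inter_determined[OF J(1,2) disj] determined_translate[OF Z]) blast+
    also have "\<dots> = (\<Prod>j\<in>J. prob Z)"
      using c_cells determined_in_sets[OF Z finite_window window_subset_cells]
      by (intro prod.cong refl prob_translate)
    finally show ?thesis using J by simp
  qed
  let ?X = "\<Inter>j\<in>J. translate (c j) -` X \<inter> configs d Q"
  have detX: "determined (window d (- R) (2 * R * m - R)) ?X"
    using J c_cells window_subset_cells cube
    by (intro determined_Inter determined_mono[OF determined_translate[OF X]]) blast+
  \<comment> \<open>Since \<open>F\<close> commutes with translations, the preimage of the tiled
    event is the tiling of the preimage, and \<open>tiles\<close> applies to it as well.\<close>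
  have vX: "F -` ?X \<inter> configs d Q =
      (\<Inter>j\<in>J. translate (c j) -` (F -` X \<inter> configs d Q) \<inter> configs d Q)"
    using J(2) c_cells translate_in_configs global_in_configs by (auto simp: global_translate)
  have nb: "shift z v \<in> window d (- R - R) (2 * R * m - R + R)"
    if "z \<in> window d (- R) (2 * R * m - R)" "v \<in> set (ca_nbhd A)" for z v
    using that V by (intro shift_in_window) auto
  \<comment> \<open>Neighbourhoods lie within distance \<open>R\<close>, so the cube grows by
    \<open>R\<close> on each side: its side goes from \<open>2 * R * m\<close> to
    \<open>2 * R * (m + 1)\<close>.\<close>
  have "2 * R * m - R - (- R) = 2 * R * int m" "2 * R * m - R + R - (- R - R) = 2 * R * int (m + 1)"
    by (simp_all add: algebra_simps)
  moreover have "nat (2 * R * int n) = nat (2 * R) * n" for n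
    using R by (simp add: nat_mult_distrib)
  ultimately have "card (window d (- R) (2 * R * m - R)) = nat (2 * R) ^ d * m ^ d"
    "card (window d (- R - R) (2 * R * m - R + R)) = nat (2 * R) ^ d * (m + 1) ^ d"
    by (simp_all only: card_window power_mult_distrib)
  then show "prob X ^ m ^ d * real (card Q) ^ (nat (2 * R) ^ d * m ^ d)
      \<le> prob (F -` X \<inter> configs d Q) ^ m ^ d * real (card Q) ^ (nat (2 * R) ^ d * (m + 1) ^ d)"
    using surjective_prob_bound[OF surj detX finite_window window_subset_cells finite_window
        window_subset_cells nb] tiles[OF X] tiles[OF Y] vX by simp
qed

text \<open>The inequality for \<open>X\<close> and the one for its complement add up to
  \<open>1\<close> on both sides, so neither can be strict.\<close>

lemma surjective_prob_eq:
  assumes surj: "ca_surjective d A" and D: "finite D" "D \<subseteq> cells d" and X: "determined D X"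
  shows "prob (F -` X \<inter> configs d Q) = prob X"
proof -
  \<comment> \<open>One window has to contain the cells of \<open>D\<close>, the cells read when
    computing the image on \<open>D\<close>, and the neighbourhood itself.\<close>
  let ?D' = "D \<union> (\<lambda>(z, v). shift z v) ` (D \<times> set (ca_nbhd A)) \<union> set (ca_nbhd A)"
  have "finite ?D'" using D by simp
  moreover have "?D' \<subseteq> cells d" using D nbhd_cells shift_in_cells by fastforce
  ultimately obtain R where R: "R > 0" "?D' \<subseteq> window d (- R) R"
    by (rule finite_subset_window)
  let ?E = "window d (- R) R"
  have le: "prob Z \<le> prob (F -` Z \<inter> configs d Q)" if Z: "determined D Z" for Z
  proof (rule surjective_prob_le[OF surj R(1)])
    show "determined ?E Z" using R(2) by (intro determined_mono[OF Z]) blast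
    show "determined ?E (F -` Z \<inter> configs d Q)"
      using R(2) by (intro determined_vimage_global[OF Z]) auto
    show "set (ca_nbhd A) \<subseteq> ?E" using R(2) by blast
  qed
  have "F -` X \<inter> configs d Q \<in> sets \<mu>"
    using R(2) by (intro determined_in_sets[OF determined_vimage_global[OF X, of ?E]] finite_window
        window_subset_cells) auto
  moreover have "F -` (configs d Q - X) \<inter> configs d Q = space \<mu> - (F -` X \<inter> configs d Q)"
    using global_in_configs by (auto simp: space_uniform)
  moreover have "X \<in> sets \<mu>" by (rule determined_in_sets[OF X D])
  ultimately show ?thesis
    using le[OF X] le[OF determined_compl[OF X]]
    by (simp add: prob_compl flip: space_uniform)
qed

text \<open>\<open>F\<close> is the explicit global function of a stochastic automaton that reads
  only random symbols, taken from the states of \<open>A\<close>.\<close>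

lemma measurable_global: "F \<in> \<mu> \<rightarrow>\<^sub>M config_algebra d Q"
proof -
  let ?B = "\<lparr>states = Q, rsyms = Q, nbhd = [], rnbhd = ca_nbhd A,
    local_fun = (\<lambda>x. ca_local_fun A (snd x))\<rparr>"
  have "is_sca d ?B"
    using ca by (auto simp: is_sca_def is_ca_def is_nbhd_def)
  moreover obtain c where "c \<in> configs d Q" using configs_nonempty by blast
  moreover have "explicit_global d ?B c = F"
    by (simp add: explicit_global_def ca_global_def fun_eq_iff)
  ultimately show ?thesis
    using measurable_explicit_global[of d ?B c] by simp
qed

text \<open>Two finite measures on the product space that agree on all boxes with finite base
  coincide, and such boxes are determined by finitely many cells.\<close>

lemma surjective_preserves_uniform:
  assumes surj: "ca_surjective d A"
  shows "distr \<mu> (config_algebra d Q) F = \<mu>"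
proof (rule measure_eqI_PiM_infinite)
  let ?U = "\<lambda>_. uniform_count_measure Q"
  show "sets (distr \<mu> (config_algebra d Q) F) = sets (\<Pi>\<^sub>M z\<in>cells d. uniform_count_measure Q)"
    "sets \<mu> = sets (\<Pi>\<^sub>M z\<in>cells d. uniform_count_measure Q)"
    by (simp_all add: uniform_config_measure_def flip: sets_uniform)
  show "finite_measure (distr \<mu> (config_algebra d Q) F)"
    by (intro finite_measure_distr measurable_global)
  fix J X assume J: "finite J" "J \<subseteq> cells d"
    and X: "\<And>z. z \<in> J \<Longrightarrow> X z \<in> sets (uniform_count_measure Q)"
  let ?C = "prod_emb (cells d) ?U J (Pi\<^sub>E J X)"
  have "determined J ?C"
    unfolding determined_def by (auto simp: prod_emb_def configs_def space_uniform_count_measure PiE_iff)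
  then have "?C \<in> sets \<mu>" "prob (F -` ?C \<inter> configs d Q) = prob ?C"
    using surjective_prob_eq[OF surj J] determined_in_sets J by blast+
  then show "emeasure (distr \<mu> (config_algebra d Q) F) ?C = emeasure \<mu> ?C"
    using measurable_global by (simp add: emeasure_distr emeasure_eq_measure sets_uniform space_uniform)
qed

section \<open>Compactness: preservation of the measure implies surjectivity\<close>

lemma closedin_determined:
  assumes X: "determined E X" and E: "finite E" "E \<subseteq> cells d"
  shows "closedin (product_topology (\<lambda>_. discrete_topology Q) (cells d)) X"
proof -
  have "openin (product_topology (\<lambda>_. discrete_topology Q) (cells d)) Y" if Y: "determined E Y" for Y
    unfolding openin_product_topology_alt
  proof (intro ballI)
    fix s assume s: "s \<in> Y"
    \<comment> \<open>Fixing the values of \<open>s\<close> on the finite set \<open>E\<close> gives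
      a basic open neighbourhood of \<open>s\<close> inside \<open>Y\<close>. Applied to the
      complement of \<open>X\<close>, this yields closedness.\<close>
    let ?U = "\<lambda>z. if z \<in> E then {s z} else Q"
    have sQ: "s \<in> configs d Q" using s Y by (auto simp: determined_def)
    have "{z \<in> cells d. ?U z \<noteq> Q} \<subseteq> E" by auto
    then have "finite {z \<in> cells d. ?U z \<noteq> Q}" using E(1) by (rule finite_subset)
    moreover have "\<forall>z\<in>cells d. ?U z \<subseteq> Q" "s \<in> Pi\<^sub>E (cells d) ?U"
      using sQ by (auto simp: configs_def PiE_iff)
    moreover have "t \<in> Y" if t: "t \<in> Pi\<^sub>E (cells d) ?U" for t
    proof -
      have "t \<in> configs d Q"
        using t \<open>\<forall>z\<in>cells d. ?U z \<subseteq> Q\<close> unfolding configs_def by (meson PiE_mono subsetD)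
      moreover have "s z = t z" if "z \<in> E" for z
        using PiE_mem[OF t subsetD[OF E(2) that]] that by simp
      ultimately show ?thesis using Y s unfolding determined_def by blast
    qed
    ultimately show "\<exists>U. finite {i \<in> cells d. U i \<noteq> topspace (discrete_topology Q)} \<and>
        (\<forall>i\<in>cells d. openin (discrete_topology Q) (U i)) \<and> s \<in> Pi\<^sub>E (cells d) U \<and>
        Pi\<^sub>E (cells d) U \<subseteq> Y"
      by (intro exI[of _ ?U]) auto
  qed
  from this[OF determined_compl[OF X]] show ?thesis
    using X by (simp add: closedin_def configs_def determined_def)
qed

text \<open>For a target \<open>c\<close>, the sets \<open>?K z\<close> are closed. Finitely many of
  them meet, because they intersect in the preimage of a cylinder, which has the positive
  probability of that cylinder. A point common to all of them is a preimage of
  \<open>c\<close>.\<close>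

lemma preserves_uniform_surjective:
  assumes eq: "distr \<mu> (config_algebra d Q) F = \<mu>"
  shows "ca_surjective d A"
proof -
  have "c \<in> F ` configs d Q" if c: "c \<in> configs d Q" for c
  proof -
    let ?T = "product_topology (\<lambda>_. discrete_topology Q) (cells d)"
    let ?K = "\<lambda>z. {s \<in> configs d Q. F s z = c z}"
    have fip: "(\<Inter>z\<in>Z. ?K z) \<noteq> {}" if Z: "finite Z" "Z \<noteq> {}" "Z \<subseteq> cells d" for Z
    proof -
      let ?X = "{s \<in> configs d Q. \<forall>z\<in>Z. s z = c z}"
      have X: "determined Z ?X" by (simp add: determined_def)
      have "patterns Z ?X = {restrict c Z}"
      proof -
        have "restrict s Z = restrict c Z" if "s \<in> ?X" for s
          using that by (intro restrict_ext) simp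
        then show ?thesis using c by blast
      qed
      then have "prob ?X > 0"
        using fin ne by (simp add: prob_determined[OF X Z(1,3)] card_gt_0_iff)
      moreover have "prob ?X = prob (F -` ?X \<inter> configs d Q)"
        using measure_distr[OF measurable_global, of ?X] determined_in_sets[OF X Z(1,3)]
        by (simp add: eq sets_uniform space_uniform)
      ultimately have "F -` ?X \<inter> configs d Q \<noteq> {}" by force
      then show ?thesis by blast
    qed
    have "compact_space ?T"
      by (simp add: compact_space_product_topology compact_space_discrete_topology fin)
    moreover have "closedin ?T (?K z)" if z: "z \<in> cells d" for z
    proof -
      have "determined {z} {s \<in> configs d Q. s z = c z}"
        by (auto simp: determined_def)
      then have "determined (shift z ` set (ca_nbhd A)) (F -` {s \<in> configs d Q. s z = c z} \<inter> configs d Q)"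
        by (rule determined_vimage_global) auto
      moreover have "F -` {s \<in> configs d Q. s z = c z} \<inter> configs d Q = ?K z"
        using global_in_configs by auto
      ultimately show ?thesis
        using z nbhd_cells by (intro closedin_determined[of "shift z ` set (ca_nbhd A)"])
          (auto intro: shift_in_cells)
    qed
    moreover have "\<Inter>\<F> \<noteq> {}" if \<F>: "finite \<F>" "\<F> \<subseteq> ?K ` cells d" for \<F>
    proof (cases "\<F> = {}")
      case False
      obtain Z where "Z \<subseteq> cells d" "finite Z" "\<F> = ?K ` Z"
        using finite_subset_image[OF \<F>] by blast
      then show ?thesis using fip[of Z] False by auto
    qed simp
    ultimately have "\<Inter>(?K ` cells d) \<noteq> {}"
      unfolding compact_space_fip by (auto simp: image_iff)
    then obtain s where s: "\<And>z. z \<in> cells d \<Longrightarrow> s \<in> ?K z" by blast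
    \<comment> \<open>Membership in \<open>?K z\<close> for a single cell already shows that
      \<open>s\<close> is a configuration; the origin provides such a cell.\<close>
    moreover have "replicate d 0 \<in> cells d" by (simp add: cells_def)
    ultimately have "s \<in> configs d Q" by blast
    moreover have "F s = c"
    proof (rule PiE_ext)
      show "F s \<in> Pi\<^sub>E (cells d) (\<lambda>_. Q)" "c \<in> Pi\<^sub>E (cells d) (\<lambda>_. Q)"
        using global_in_configs[OF \<open>s \<in> configs d Q\<close>] c by (simp_all add: configs_def)
    qed (use s in blast)
    ultimately show ?thesis by blast
  qed
  then show ?thesis
    using global_in_configs by (auto simp: ca_surjective_def)
qed

lemma surjective_iff_preserves_uniform:
  "ca_surjective d A \<longleftrightarrow> distr \<mu> (config_algebra d Q) F = \<mu>"
  using surjective_preserves_uniform preserves_uniform_surjective by blast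

end

section \<open>The reduction\<close>

text \<open>The empty list is the only tuple over the empty neighbourhood. The reversal matches the
  output order of \<open>rev_map_code\<close>, here and in \<open>noise_graph\<close>.\<close>

definition random_graph ::
  "(nat list \<times> nat) list \<Rightarrow> ((nat list \<times> nat list) \<times> nat) list" where
  "random_graph T = rev (map (\<lambda>(w, q). (([], w), q)) T)"

definition noise_graph :: "nat list \<Rightarrow> ((nat list \<times> nat list) \<times> nat) list" where
  "noise_graph Q = rev (map (\<lambda>q. (([], [q]), q)) Q)"

fun random_desc :: "ca_desc \<Rightarrow> sca_desc" where
  "random_desc (Q, V, T) = (Q, Q, [], V, random_graph T)"

text \<open>The random neighbourhood is the origin alone, so each cell copies its own random
  symbol.\<close>

fun noise_desc :: "nat \<Rightarrow> ca_desc \<Rightarrow> sca_desc" where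
  "noise_desc d (Q, V, T) = (Q, Q, [], [replicate d 0], noise_graph Q)"

text \<open>This is the construction on codes: \<open>q\<close>, \<open>v\<close> and
  \<open>t\<close> are the codes of the states, the neighbourhood and the graph, \<open>0\<close> is
  the code of \<open>[]\<close>, and \<open>Suc (prod_encode (x, 0))\<close> that of
  \<open>[x]\<close>.\<close>

definition reduction :: "nat \<Rightarrow> nat \<Rightarrow> nat" where
  "reduction d n =
     (let q = fst (prod_decode n); v = fst (prod_decode (snd (prod_decode n)));
          t = snd (prod_decode (snd (prod_decode n)))
      in prod_encode
        (prod_encode (q, prod_encode (q, prod_encode (0, prod_encode (v, rev_map_code
           (\<lambda>e. prod_encode (prod_encode (0, fst (prod_decode e)), snd (prod_decode e))) t)))),
         prod_encode (q, prod_encode (q, prod_encode (0, prod_encode (code_nbhd [replicate d 0],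
           rev_map_code (\<lambda>x. prod_encode (prod_encode (0, Suc (prod_encode (x, 0))), x)) q))))))"

lemma computable_reduction: "computable (reduction d)"
  unfolding reduction_def Let_def
  by (intro computable_if_recursive recursive_prod_encode recursive_fst_decode recursive_snd_decode
      recursive_rev_map_code recursive_Suc recursive_const recursive_proj) simp_all

lemma reduction_code_ca:
  "reduction d (code_ca D) = code_pair code_sca code_sca (random_desc D, noise_desc d D)"
proof -
  obtain Q V T where D: "D = (Q, V, T)" by (cases D)
  show ?thesis
    by (simp add: D reduction_def Let_def random_graph_def noise_graph_def code_ca_def
        code_sca_def code_pair_def code_syms_def code_nbhd_def code_list_def rev_map_code_list_encode rev_map case_prod_beta comp_def)
qed

lemma keys_random_graph: "map fst (random_graph T) = rev (map (Pair []) (map fst T))"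
  by (simp add: random_graph_def rev_map case_prod_beta comp_def)

lemma keys_noise_graph: "map fst (noise_graph Q) = rev (map (\<lambda>q. ([], [q])) Q)"
  by (simp add: noise_graph_def rev_map comp_def)

lemma distinct_keys_random_graph:
  "distinct (map fst T) \<Longrightarrow> distinct (map fst (random_graph T))"
  unfolding keys_random_graph distinct_rev distinct_map[of "Pair []"] by (simp add: inj_on_def)

lemma distinct_keys_noise_graph: "distinct Q \<Longrightarrow> distinct (map fst (noise_graph Q))"
  unfolding keys_noise_graph by (simp add: distinct_map inj_on_def)

lemma map_of_random_graph:
  assumes "distinct (map fst T)"
  shows "map_of (random_graph T) ([], w) = map_of T w"
proof -
  let ?G = "map (\<lambda>(w, q). (([] :: nat list, w), q)) T"
  \<comment> \<open>With distinct keys, \<open>map_of\<close> depends only on the set of pairs, so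
    the reversal is harmless.\<close>
  have "map_of (random_graph T) = map_of ?G"
    using distinct_keys_random_graph[OF assms]
    by (intro map_of_inject_set[THEN iffD2])
      (simp_all add: random_graph_def rev_map[symmetric] del: map_map)
  moreover have "map_of ?G ([], w) = map_of T w"
    by (induction T) auto
  ultimately show ?thesis by simp
qed

lemma map_of_noise_graph: "distinct Q \<Longrightarrow> x \<in> set Q \<Longrightarrow> map_of (noise_graph Q) ([], [x]) = Some x"
  by (intro map_of_is_SomeI distinct_keys_noise_graph) (simp_all add: noise_graph_def)

lemma tuples_0: "tuples Q 0 = {[]}"
  by (auto simp: tuples_def)

lemma tuples_1: "tuples Q (Suc 0) = (\<lambda>q. [q]) ` Q"
  by (auto simp: tuples_def length_Suc_conv)

lemma explicit_global_random_desc: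
  assumes "is_ca_desc d D"
  shows "explicit_global d (sca_of (random_desc D)) c = ca_global d (ca_of D)"
proof -
  obtain Q V T where D: "D = (Q, V, T)" by (cases D)
  then have "distinct (map fst T)" using assms by simp
  then show ?thesis
    by (simp add: D explicit_global_def ca_global_def map_of_random_graph fun_eq_iff)
qed

lemma is_sca_desc_random_desc:
  assumes D: "is_ca_desc d D"
  shows "is_sca_desc d (random_desc D)"
proof -
  obtain Q V T where D': "D = (Q, V, T)" by (cases D)
  have T: "distinct (map fst T)" "set (map fst T) = tuples (set Q) (length V)"
    using D D' by simp_all
  have "set (map fst (random_graph T)) = tuples (set Q) 0 \<times> tuples (set Q) (length V)"
    unfolding keys_random_graph set_rev set_map[of "Pair []"] T(2) tuples_0 by auto
  moreover have "is_sca d (sca_of (random_desc D))"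
    using D by (auto simp: D' is_sca_def is_ca_def tuples_0 map_of_random_graph[OF T(1)] is_nbhd_def)
  ultimately show ?thesis
    using D D' distinct_keys_random_graph[OF T(1)] by simp
qed

lemma explicit_global_noise_desc:
  assumes "is_ca_desc d D" and s: "s \<in> configs d (ca_states (ca_of D))"
  shows "explicit_global d (sca_of (noise_desc d D)) c s = s"
proof -
  obtain Q V T where D: "D = (Q, V, T)" by (cases D)
  have shift: "shift z (replicate d 0) = z" if "z \<in> cells d" for z
    using that by (auto simp: shift_def cells_def intro: nth_equalityI)
  have "s z \<in> set Q" if "z \<in> cells d" for z
    using s that by (auto simp: D configs_def)
  moreover have "distinct Q" using assms D by simp
  ultimately have "explicit_global d (sca_of (noise_desc d D)) c s = restrict s (cells d)"
    unfolding explicit_global_def by (intro restrict_ext) (simp add: D shift map_of_noise_graph)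
  then show ?thesis using s by (simp add: configs_def PiE_restrict)
qed

lemma is_sca_desc_noise_desc:
  assumes D: "is_ca_desc d D"
  shows "is_sca_desc d (noise_desc d D)"
proof -
  obtain Q V T where D': "D = (Q, V, T)" by (cases D)
  have Q: "distinct Q" using D D' by simp
  have "set (map fst (noise_graph Q)) = tuples (set Q) 0 \<times> tuples (set Q) (Suc 0)"
    unfolding keys_noise_graph tuples_0 tuples_1 by auto
  moreover have "is_sca d (sca_of (noise_desc d D))"
    using D by (auto simp: D' is_sca_def is_ca_def tuples_0 tuples_1 is_nbhd_def cells_def
        map_of_noise_graph[OF Q])
  ultimately show ?thesis
    using Q D' distinct_keys_noise_graph[OF Q] by simp
qed

lemma states_descs:
  "states (sca_of (random_desc D)) = ca_states (ca_of D)"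
  "rsyms (sca_of (random_desc D)) = ca_states (ca_of D)"
  "states (sca_of (noise_desc d D)) = ca_states (ca_of D)"
  "rsyms (sca_of (noise_desc d D)) = ca_states (ca_of D)"
  by (cases D; simp)+

lemma classical_automaton_ca_of: "is_ca_desc d D \<Longrightarrow> classical_automaton d (ca_of D)"
  by (cases D) (simp add: classical_automaton_def)

lemma same_nondet_iff_surjective:
  assumes D: "is_ca_desc d D"
  shows "same_nondet d (sca_of (random_desc D)) (sca_of (noise_desc d D)) \<longleftrightarrow>
    ca_surjective d (ca_of D)"
proof -
  interpret classical_automaton d "ca_of D" using D by (rule classical_automaton_ca_of)
  have "nondet_global d (sca_of (random_desc D)) c = F ` configs d Q" for c
    by (auto simp: nondet_global_def explicit_global_random_desc[OF D] states_descs)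
  moreover have "nondet_global d (sca_of (noise_desc d D)) c = configs d Q" for c
    by (force simp: nondet_global_def explicit_global_noise_desc[OF D] states_descs)
  \<comment> \<open>Neither set depends on \<open>c\<close>; as there is at least one configuration,
    equality for all \<open>c\<close> is the single equation expressing surjectivity.\<close>
  ultimately show ?thesis
    using configs_nonempty by (auto simp: same_nondet_def ca_surjective_def states_descs)
qed

text \<open>The first automaton has the image of \<mu> under \<open>F\<close> as its law and the
  second has \<mu>, for every \<open>c\<close>. Equality of the laws is therefore preservation of
  \<mu>.\<close>

lemma same_stochastic_iff_surjective:
  assumes D: "is_ca_desc d D"
  shows "same_stochastic d (sca_of (random_desc D)) (sca_of (noise_desc d D)) \<longleftrightarrow>
    ca_surjective d (ca_of D)"
proof -
  interpret classical_automaton d "ca_of D" using D by (rule classical_automaton_ca_of)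
  have "stochastic_global d (sca_of (random_desc D)) c = distr \<mu> (config_algebra d Q) F" for c
    by (simp add: stochastic_global_def explicit_global_random_desc[OF D] states_descs)
  moreover have "stochastic_global d (sca_of (noise_desc d D)) c = \<mu>" for c
  proof -
    have "stochastic_global d (sca_of (noise_desc d D)) c = distr \<mu> \<mu> (\<lambda>s. s)"
      unfolding stochastic_global_def states_descs
      by (intro distr_cong) (simp_all add: explicit_global_noise_desc[OF D] sets_uniform space_uniform)
    then show ?thesis by simp
  qed
  ultimately show ?thesis
    using configs_nonempty
    by (auto simp: same_stochastic_def states_descs surjective_iff_preserves_uniform)
qed

theorem theorem4p1:
  fixes d :: nat
  assumes "d \<ge> 1"
  shows "reducible (surjectivity_problem d) (nondet_equality_problem d) \<and>
         reducible (surjectivity_problem d) (stochastic_equality_problem d)"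
proof -
  let ?code = "code_pair code_sca code_sca"
  \<comment> \<open>Yes-instances are codes of some suitable description; injectivity of the codes
    ensures that it is the description at hand.\<close>
  have ca_eq: "code_ca D = code_ca D' \<longleftrightarrow> D = D'" for D D'
    using inj_code_ca by (simp add: inj_eq)
  have pair_eq: "?code P = ?code P' \<longleftrightarrow> P = P'" for P P'
    using inj_code_pair[OF inj_code_sca inj_code_sca] by (simp add: inj_eq)
  \<comment> \<open>Both target problems have this shape and differ only in the relation
    \<open>S\<close>, so one computable map serves for both.\<close>
  have red: "reducible (surjectivity_problem d)
      \<lparr>instances = {?code (D, E) | D E. is_sca_desc d D \<and> is_sca_desc d E},
       yes_instances = {?code (D, E) | D E. is_sca_desc d D \<and> is_sca_desc d E \<and> S D E}\<rparr>"
    (is "reducible _ ?P")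
    if S: "\<And>D. is_ca_desc d D \<Longrightarrow> S (random_desc D) (noise_desc d D) \<longleftrightarrow> ca_surjective d (ca_of D)"
    for S
    unfolding reducible_def
  proof (intro exI[of _ "reduction d"] conjI computable_reduction ballI)
    fix n assume "n \<in> instances (surjectivity_problem d)"
    then obtain D where n: "n = code_ca D" and D: "is_ca_desc d D"
      unfolding surjectivity_problem_def decision_problem.simps by blast
    have sca: "is_sca_desc d (random_desc D)" "is_sca_desc d (noise_desc d D)"
      using D is_sca_desc_random_desc is_sca_desc_noise_desc by blast+
    then show "reduction d n \<in> instances ?P"
      unfolding n reduction_code_ca decision_problem.simps by blast
    have "n \<in> yes_instances (surjectivity_problem d) \<longleftrightarrow> ca_surjective d (ca_of D)"
      unfolding n surjectivity_problem_def decision_problem.simps mem_Collect_eq ca_eq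
      using D by blast
    moreover have "reduction d n \<in> yes_instances ?P \<longleftrightarrow> S (random_desc D) (noise_desc d D)"
      unfolding n reduction_code_ca decision_problem.simps mem_Collect_eq pair_eq prod.inject
      using sca by blast
    ultimately show "n \<in> yes_instances (surjectivity_problem d) \<longleftrightarrow> reduction d n \<in> yes_instances ?P"
      using S[OF D] by blast
  qed
  show ?thesis
    unfolding nondet_equality_problem_def stochastic_equality_problem_def
    using same_nondet_iff_surjective same_stochastic_iff_surjective by (intro conjI red)
qed

end
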